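(* Let $G$ be a finite abelian group of order $n\ge 2$ and exponent $q$, and let $l$ be the order of its subgroup $L$ of elements of order at most $2$. Then for every integer $h$ with $$(n+l)/2-1 \le h \le n-2$$ we have $C_h(G)=Z_h(G)=h+1$, with the following two exceptions: (i) if $h=n-3$ and $q=3$, then $C_h(G)=h+1$ and $Z_h(G)=h$; (ii) if $h=n-2$, $l=2$, and $q\equiv 2 \pmod 4$, then $C_h(G)=h+1$ and $Z_h(G)=h$.
   Context: $G$ is written additively. $L=\{g\in G: 2g=0\}$ is the subgroup consisting of $0$ and all involutions. For a subset $A\subseteq G$ and positive integer $h$, the $h$-fold restricted sumset $h\hat{\;}A$ is the set of all elements of $G$ that can be written as a sum of $h$ pairwise distinct elements of $A$. Define $C_h(G)=\max\{|A| : A\subseteq G,\ h\hat{\;}A\neq G\}$ and $Z_h(G)=\max\{|A| : A\subseteq G,\ 0\notin h\hat{\;}A\}$. *)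

theory Defs
  imports "HOL-Algebra.Algebra"
begin

text \<open>
  Abelian groups are the library's \<^locale>\<open>comm_group\<close>, whose operation is written
  multiplicatively: the additive \<open>x + y\<close>, \<open>0\<close>, \<open>k x\<close> and \<open>\<Sum>x\<in>B. x\<close> appear as
  \<open>x \<otimes> y\<close>, \<open>\<one>\<close>, \<open>x [^] k\<close> and \<open>\<Otimes>x\<in>B. x\<close>.
\<close>

definition involution_subgroup :: "('a, 'b) monoid_scheme \<Rightarrow> 'a set" where
  "involution_subgroup G = {g \<in> carrier G. g [^]\<^bsub>G\<^esub> (2::nat) = \<one>\<^bsub>G\<^esub>}"

definition group_exponent :: "('a, 'b) monoid_scheme \<Rightarrow> nat" where
  "group_exponent G =
     (LEAST q. q > 0 \<and> (\<forall>g \<in> carrier G. g [^]\<^bsub>G\<^esub> q = \<one>\<^bsub>G\<^esub>))"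

text \<open>A sum of \<open>h\<close> pairwise distinct elements of \<open>A\<close> is the sum over an \<open>h\<close>-element subset.\<close>

definition restricted_sumset :: "('a, 'b) monoid_scheme \<Rightarrow> nat \<Rightarrow> 'a set \<Rightarrow> 'a set" where
  "restricted_sumset G h A =
     {(\<Otimes>\<^bsub>G\<^esub>x\<in>B. x) | B. B \<subseteq> A \<and> finite B \<and> card B = h}"

text \<open>
  For finite \<open>G\<close> and \<open>h \<ge> 1\<close> the sets below are finite and nonempty (\<open>A = {}\<close> is
  always admissible), so \<^const>\<open>Max\<close> is a genuine maximum.
\<close>

definition C_num :: "('a, 'b) monoid_scheme \<Rightarrow> nat \<Rightarrow> nat" where
  "C_num G h = Max {card A | A. A \<subseteq> carrier G \<and> restricted_sumset G h A \<noteq> carrier G}"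

definition Z_num :: "('a, 'b) monoid_scheme \<Rightarrow> nat \<Rightarrow> nat" where
  "Z_num G h = Max {card A | A. A \<subseteq> carrier G \<and> \<one>\<^bsub>G\<^esub> \<notin> restricted_sumset G h A}"

end

theory Submission
  imports Defs
begin

text \<open>
  If \<open>|A| = h + 2\<close>, then \<open>h^A\<close> is the sum \<open>\<sigma>(A)\<close> minus the set of sums of two distinct elements
  of \<open>A\<close>; a count against the at most \<open>l\<close> solutions of \<open>2x = t\<close> shows that the latter is all
  of \<open>G\<close>, while \<open>|h^A| \<le> h + 1 < n\<close> if \<open>|A| = h + 1\<close>. So \<open>C = h + 1\<close>, and \<open>Z \<ge> h + 1\<close> says that some
  \<open>A\<close> of size \<open>h + 1\<close> has \<open>\<sigma>(A) \<notin> A\<close>. With \<open>s = \<sigma>(G)\<close> this means that the complement \<open>B\<close>,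
  whose size \<open>k\<close> satisfies \<open>1 \<le> k \<le> (n - l) / 2\<close>, has an element \<open>b\<close> with \<open>\<sigma>(B) + b = s\<close>.
  A set \<open>T\<close> with this property can be enlarged by pairs \<open>{x, -x}\<close>, so only small sets \<open>T\<close> of both
  parities are needed: \<open>{b}\<close> with \<open>2b = s\<close>, or else \<open>{0, x, s - x}\<close>, for odd \<open>k\<close>; \<open>{b, s - 2b}\<close> with
  \<open>3b \<noteq> s\<close>, or \<open>{0, x, y, -x - y}\<close> if \<open>q = 3\<close>, for even \<open>k\<close>. The exceptions are the cases \<open>k = 1\<close>
  with \<open>2b = s\<close> unsolvable and \<open>k = 2\<close> with \<open>q = 3\<close>.
\<close>

section \<open>Selections from finite sets\<close>

text \<open>Every orbit of a fixed-point-free involution has two elements, so adding one orbit at a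
  time reaches every even size. It is applied with \<open>f\<close> the inversion map.\<close>

lemma ex_involution_closed_subset:
  assumes "finite S"
    and f: "\<And>x. x \<in> S \<Longrightarrow> f x \<in> S" "\<And>x. x \<in> S \<Longrightarrow> f x \<noteq> x" "\<And>x. x \<in> S \<Longrightarrow> f (f x) = x"
    and "2 * j \<le> card S"
  shows "\<exists>T\<subseteq>S. card T = 2 * j \<and> f ` T \<subseteq> T"
  using assms(5)
proof (induction j)
  case 0
  then show ?case by (intro exI[of _ "{}"]) auto
next
  case (Suc j)
  then obtain T where T: "T \<subseteq> S" "card T = 2 * j" "f ` T \<subseteq> T" by auto
  have finT: "finite T" using T(1) assms(1) by (rule finite_subset)
  have "T \<noteq> S" using T(2) Suc.prems by auto
  then obtain x where x: "x \<in> S" "x \<notin> T" using T(1) by auto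
  have "f x \<notin> T" using x T(3) f(3) by (metis image_subset_iff)
  then have "card (insert x (insert (f x) T)) = 2 * Suc j"
    using x f(2)[of x] finT T(2) by simp
  moreover have "f ` insert x (insert (f x) T) \<subseteq> insert x (insert (f x) T)"
    using T(3) f(3)[OF x(1)] by auto
  ultimately show ?case using x f(1) T(1)
    by (intro exI[of _ "insert x (insert (f x) T)"]) auto
qed

lemma ex_notin_card_less:
  assumes "finite F" "card F < card M"
  obtains x where "x \<in> M" "x \<notin> F"
  using assms by (metis card_mono linorder_not_le subsetI)

context comm_group
begin

section \<open>Products over subsets of the group\<close>

lemma finprod_id_closed: "A \<subseteq> carrier G \<Longrightarrow> (\<Otimes>x\<in>A. x) \<in> carrier G"
  by (intro finprod_closed) auto

lemma finprod_id_insert: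
  "\<lbrakk>finite A; a \<notin> A; A \<subseteq> carrier G; a \<in> carrier G\<rbrakk> \<Longrightarrow> (\<Otimes>x\<in>insert a A. x) = a \<otimes> (\<Otimes>x\<in>A. x)"
  by (rule finprod_insert) auto

lemma finprod_id_Un_disjoint:
  "\<lbrakk>finite A; finite B; A \<inter> B = {}; A \<subseteq> carrier G; B \<subseteq> carrier G\<rbrakk>
    \<Longrightarrow> (\<Otimes>x\<in>A \<union> B. x) = (\<Otimes>x\<in>A. x) \<otimes> (\<Otimes>x\<in>B. x)"
  by (rule finprod_Un_disjoint) auto

lemma finprod_id_remove:
  assumes "finite A" "A \<subseteq> carrier G" "a \<in> A"
  shows "(\<Otimes>x\<in>A. x) = a \<otimes> (\<Otimes>x\<in>A - {a}. x)"
proof -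
  have "insert a (A - {a}) = A" using assms by auto
  then show ?thesis using finprod_id_insert[of "A - {a}" a] assms by auto
qed

text \<open>\<open>S\<close> splits into \<open>card S div 2\<close> pairs \<open>{x, f x}\<close>,
  each contributing \<open>c\<close>; the induction removes one pair. Inversion gives the case
  \<open>c = 1\<close>, translation by an involution \<open>u\<close> the case
  \<open>c = u\<close>.\<close>

lemma finprod_id_involution:
  assumes "finite S" "S \<subseteq> carrier G" "c \<in> carrier G"
    and "\<And>x. x \<in> S \<Longrightarrow> f x \<in> S" "\<And>x. x \<in> S \<Longrightarrow> f x \<noteq> x" "\<And>x. x \<in> S \<Longrightarrow> f (f x) = x"
    and "\<And>x. x \<in> S \<Longrightarrow> x \<otimes> f x = c"
  shows "(\<Otimes>x\<in>S. x) = c [^] (card S div 2)"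
  using assms
proof (induction "card S" arbitrary: S rule: less_induct)
  case less
  show ?case
  proof (cases "S = {}")
    case True
    then show ?thesis by simp
  next
    case False
    then obtain x where x: "x \<in> S" by auto
    define S' where "S' = S - {x, f x}"
    note fx = less.prems(4-7)[OF x]
    have S: "S = insert x (insert (f x) S')" using x fx(1) S'_def by auto
    have fin: "finite S'" using less.prems(1) S'_def by auto
    have sub: "S' \<subseteq> carrier G" using less.prems(2) S'_def by auto
    have xc: "x \<in> carrier G" "f x \<in> carrier G" using x fx(1) less.prems(2) by auto
    have nin: "f x \<notin> S'" "x \<notin> insert (f x) S'" using fx(2) S'_def by auto
    have card: "card S = Suc (Suc (card S'))"
      by (subst S) (use nin fin in simp)
    have "(\<Otimes>x\<in>S'. x) = c [^] (card S' div 2)"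
    proof (rule less.hyps)
      show "card S' < card S" using card by simp
      fix y assume y: "y \<in> S'"
      then have yS: "y \<in> S" and "y \<noteq> x" "y \<noteq> f x" by (auto simp: S'_def)
      have "f y \<noteq> x" using less.prems(6)[OF yS] \<open>y \<noteq> f x\<close> by auto
      moreover have "f y \<noteq> f x" using less.prems(6)[OF yS] fx(3) \<open>y \<noteq> x\<close> by auto
      ultimately show "f y \<in> S'" using less.prems(4)[OF yS] by (auto simp: S'_def)
      show "f y \<noteq> y" "f (f y) = y" "y \<otimes> f y = c" using less.prems(5-7)[OF yS] by auto
    qed (use fin sub less.prems(3) in auto)
    moreover have "(\<Otimes>x\<in>S. x) = x \<otimes> (f x \<otimes> (\<Otimes>x\<in>S'. x))"
      by (subst S) (use nin fin sub xc in \<open>simp add: finprod_id_insert\<close>)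
    ultimately have "(\<Otimes>x\<in>S. x) = c \<otimes> c [^] (card S' div 2)"
      using xc fx(4) finprod_id_closed[OF sub] m_assoc[of x "f x"] less.prems(3) by simp
    also have "\<dots> = c [^] (card S div 2)"
      using less.prems(3) nat_pow_Suc2 card by simp
    finally show ?thesis .
  qed
qed

section \<open>The subgroup \<open>L\<close> and the product over the whole group\<close>

lemma involution_subgroup_iff:
  "x \<in> involution_subgroup G \<longleftrightarrow> x \<in> carrier G \<and> x \<otimes> x = \<one>"
  by (auto simp: involution_subgroup_def numeral_2_eq_2)

lemma involution_subgroup_mult:
  assumes "x \<in> involution_subgroup G" "y \<in> involution_subgroup G"
  shows "x \<otimes> y \<in> involution_subgroup G"
  using assms by (auto simp: involution_subgroup_def pow_mult_distrib m_comm)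

lemma inv_eq_self_iff:
  assumes "x \<in> carrier G"
  shows "inv x = x \<longleftrightarrow> x \<in> involution_subgroup G"
  using assms by (metis inv_equality involution_subgroup_iff r_inv)

lemma one_in_involution_subgroup: "\<one> \<in> involution_subgroup G"
  by (simp add: involution_subgroup_iff)

text \<open>Outside \<open>L\<close> each element differs from its inverse, and the two
  cancel.\<close>

lemma finprod_carrier_eq_involution_subgroup:
  assumes "finite (carrier G)"
  shows "(\<Otimes>x\<in>carrier G. x) = (\<Otimes>x\<in>involution_subgroup G. x)"
proof -
  let ?L = "involution_subgroup G"
  have L: "?L \<subseteq> carrier G" by (auto simp: involution_subgroup_def)
  have finL: "finite ?L" using L assms by (rule finite_subset)
  have "(\<Otimes>x\<in>carrier G - ?L. x) = \<one> [^] (card (carrier G - ?L) div 2)"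
  proof (rule finprod_id_involution[where f = "\<lambda>x. inv x"])
    fix x assume x: "x \<in> carrier G - ?L"
    show "inv x \<in> carrier G - ?L" using x by (metis Diff_iff inv_closed inv_eq_self_iff inv_inv)
    show "inv x \<noteq> x" using x inv_eq_self_iff by auto
  qed (use assms in auto)
  moreover have "carrier G = ?L \<union> (carrier G - ?L)" using L by auto
  ultimately show ?thesis
    using finprod_id_Un_disjoint[of ?L "carrier G - ?L"] finL L assms finprod_id_closed[OF L]
    by auto
qed

text \<open>Translation by \<open>u\<close> pairs off \<open>L\<close>, and \<open>x\<close> times
  \<open>u x\<close> is \<open>u\<close> because \<open>x\<close> squares to one.\<close>

lemma finprod_carrier_eq_pow:
  assumes "finite (carrier G)" "u \<in> involution_subgroup G" "u \<noteq> \<one>"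
  shows "(\<Otimes>x\<in>carrier G. x) = u [^] (card (involution_subgroup G) div 2)"
proof -
  let ?L = "involution_subgroup G"
  have L: "?L \<subseteq> carrier G" by (auto simp: involution_subgroup_def)
  have finL: "finite ?L" using L assms(1) by (rule finite_subset)
  have u: "u \<in> carrier G" "u \<otimes> u = \<one>" using assms(2) by (auto simp: involution_subgroup_iff)
  have "(\<Otimes>x\<in>?L. x) = u [^] (card ?L div 2)"
  proof (rule finprod_id_involution[where f = "\<lambda>x. u \<otimes> x"])
    fix x assume x: "x \<in> ?L"
    then have xc: "x \<in> carrier G" "x \<otimes> x = \<one>" by (auto simp: involution_subgroup_iff)
    show "u \<otimes> x \<in> ?L" using assms(2) x by (rule involution_subgroup_mult)
    show "u \<otimes> x \<noteq> x" using assms(3) u xc by (metis l_one one_closed right_cancel)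
    show "u \<otimes> (u \<otimes> x) = x" using u xc by (metis l_one m_assoc)
    show "x \<otimes> (u \<otimes> x) = u" using u xc by (simp add: m_lcomm)
  qed (use finL L u in auto)
  then show ?thesis using finprod_carrier_eq_involution_subgroup[OF assms(1)] by simp
qed

lemma finprod_carrier_eq_involution:
  assumes "finite (carrier G)" "card (involution_subgroup G) = 2"
    and "u \<in> involution_subgroup G" "u \<noteq> \<one>"
  shows "(\<Otimes>x\<in>carrier G. x) = u"
  using finprod_carrier_eq_pow[OF assms(1,3,4)] assms(2,3) by (simp add: involution_subgroup_iff)

text \<open>If \<open>L\<close> is nontrivial, it contains two distinct involutions \<open>u\<close>
  and \<open>v\<close>. The product equals both the \<open>?m\<close>-th power of \<open>u\<close>
  and that of \<open>v\<close>; for odd \<open>?m\<close> this would give \<open>u = v\<close>, so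
  \<open>?m\<close> is even and the power is one.\<close>

lemma finprod_carrier_eq_one:
  assumes fin: "finite (carrier G)" and l: "card (involution_subgroup G) \<noteq> 2"
  shows "(\<Otimes>x\<in>carrier G. x) = \<one>"
proof (cases "involution_subgroup G = {\<one>}")
  case True
  then show ?thesis using finprod_carrier_eq_involution_subgroup[OF fin] by simp
next
  case False
  let ?L = "involution_subgroup G" and ?m = "card (involution_subgroup G) div 2"
  obtain u where u: "u \<in> ?L" "u \<noteq> \<one>" using False one_in_involution_subgroup by auto
  have "?L \<noteq> {\<one>, u}" using l u by auto
  then obtain v where v: "v \<in> ?L" "v \<noteq> \<one>" "v \<noteq> u"
    using u one_in_involution_subgroup by auto
  have pow: "w [^] ?m = (if even ?m then \<one> else w)" if "w \<in> ?L" for w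
  proof -
    have w: "w \<in> carrier G" "w [^] (2::nat) = \<one>" using that by (auto simp: involution_subgroup_def)
    have ev: "w [^] (2 * i) = \<one>" for i :: nat using w nat_pow_pow[of w 2 i] by simp
    show ?thesis
    proof (cases "even ?m")
      case True
      then show ?thesis using ev by (metis dvdE)
    next
      case False
      then obtain i where "?m = Suc (2 * i)" by (metis oddE Suc_eq_plus1)
      then show ?thesis using w False ev by simp
    qed
  qed
  show ?thesis
    using finprod_carrier_eq_pow[OF fin] u v pow by metis
qed

section \<open>Covering the group by restricted sumsets\<close>

text \<open>The square roots of \<open>t\<close>, if there are any, form a coset of
  \<open>L\<close>: dividing by a fixed root \<open>c\<close> embeds them into
  \<open>L\<close>.\<close>

lemma card_square_roots_le:
  assumes "finite (carrier G)"
  shows "card {a \<in> carrier G. a \<otimes> a = t} \<le> card (involution_subgroup G)"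
proof (cases "{a \<in> carrier G. a \<otimes> a = t} = {}")
  case False
  then obtain c where c: "c \<in> carrier G" "c \<otimes> c = t" by auto
  have finL: "finite (involution_subgroup G)"
    using assms by (auto simp: involution_subgroup_def)
  show ?thesis
  proof (rule card_inj_on_le[where f = "\<lambda>a. a \<otimes> inv c"])
    show "inj_on (\<lambda>a. a \<otimes> inv c) {a \<in> carrier G. a \<otimes> a = t}"
      using c by (auto simp: inj_on_def)
    have "(a \<otimes> inv c) \<otimes> (a \<otimes> inv c) = \<one>" if a: "a \<in> carrier G" "a \<otimes> a = t" for a
    proof -
      have "(a \<otimes> inv c) \<otimes> (a \<otimes> inv c) = (a \<otimes> a) \<otimes> (inv c \<otimes> inv c)"
        using a(1) c(1) by (simp add: m_ac)
      also have "inv c \<otimes> inv c = inv (c \<otimes> c)" using c(1) by (simp add: inv_mult)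
      also have "(a \<otimes> a) \<otimes> inv (c \<otimes> c) = \<one>" unfolding a(2) c(2) using a by auto
      finally show ?thesis .
    qed
    then show "(\<lambda>a. a \<otimes> inv c) ` {a \<in> carrier G. a \<otimes> a = t} \<subseteq> involution_subgroup G"
      using c by (auto simp: involution_subgroup_iff)
  qed (rule finL)
next
  case True
  show ?thesis unfolding True by simp
qed

text \<open>\<open>A\<close> and its reflection \<open>A'\<close> (all \<open>t\<close> divided by
  elements of \<open>A\<close>) share at least \<open>2 * card A - order G\<close> elements, which
  is more than the number of square roots of \<open>t\<close>.\<close>

lemma ex_distinct_mult_eq:
  assumes fin: "finite (carrier G)" and A: "A \<subseteq> carrier G" and t: "t \<in> carrier G"
    and card: "order G + card (involution_subgroup G) < 2 * card A"
  shows "\<exists>a\<in>A. \<exists>b\<in>A. a \<noteq> b \<and> a \<otimes> b = t"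
proof (rule ccontr)
  assume neg: "\<not> ?thesis"
  define A' where "A' = (\<lambda>a. t \<otimes> inv a) ` A"
  have finA: "finite A" using A fin by (rule finite_subset)
  have inj: "inj_on (\<lambda>a. t \<otimes> inv a) A"
    using A t by (intro inj_onI) (metis inv_closed inv_inv l_cancel subsetD)
  have card': "card A' = card A" using inj by (simp add: A'_def card_image)
  have sub: "A' \<subseteq> carrier G" using A t by (auto simp: A'_def)
  have "card (A \<union> A') \<le> order G"
    unfolding order_def using A sub fin by (intro card_mono) auto
  moreover have "card A + card A' = card (A \<union> A') + card (A \<inter> A')"
    using finA by (intro card_Un_Int) (auto simp: A'_def)
  \<comment> \<open>A common element \<open>b\<close> yields a factorization of \<open>t\<close>
    into \<open>b\<close> and some \<open>a\<close> in \<open>A\<close>; without a factorization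
    into distinct elements, \<open>b = a\<close> is a square root of \<open>t\<close>.\<close>
  moreover have "A \<inter> A' \<subseteq> {a \<in> carrier G. a \<otimes> a = t}"
  proof
    fix b assume "b \<in> A \<inter> A'"
    then obtain a where ab: "a \<in> A" "b \<in> A" "b = t \<otimes> inv a" by (auto simp: A'_def)
    then have "a \<in> carrier G" "b \<in> carrier G" using A by auto
    then have ba: "b \<otimes> a = t" using ab(3) t by (simp add: m_assoc)
    then have "b = a" using neg ab(1,2) by blast
    then show "b \<in> {a \<in> carrier G. a \<otimes> a = t}" using ba \<open>b \<in> carrier G\<close> by auto
  qed
  then have "card (A \<inter> A') \<le> card {a \<in> carrier G. a \<otimes> a = t}"
    using fin by (intro card_mono) auto
  then have "card (A \<inter> A') \<le> card (involution_subgroup G)"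
    using card_square_roots_le[OF fin, of t] by linarith
  ultimately show False using card card' by simp
qed

lemma restricted_sumset_eq_carrier:
  assumes fin: "finite (carrier G)" and A: "A \<subseteq> carrier G" and hA: "h + 2 \<le> card A"
    and nl: "order G + card (involution_subgroup G) < 2 * (h + 2)"
  shows "restricted_sumset G h A = carrier G"
proof
  show "restricted_sumset G h A \<subseteq> carrier G"
    using A by (auto simp: restricted_sumset_def intro!: finprod_id_closed)
  show "carrier G \<subseteq> restricted_sumset G h A"
  proof
    fix g assume g: "g \<in> carrier G"
    obtain D where D: "D \<subseteq> A" "card D = h + 2" "finite D"
      using hA by (meson obtain_subset_with_card_n)
    have Dc: "D \<subseteq> carrier G" using D A by auto
    define p where "p = (\<Otimes>x\<in>D. x)"
    have p: "p \<in> carrier G" using Dc by (simp add: p_def finprod_id_closed)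
    \<comment> \<open>The product of the pair is prescribed so that deleting the pair from
      \<open>D\<close> leaves \<open>h\<close> elements with product \<open>g\<close>.\<close>
    obtain a b where ab: "a \<in> D" "b \<in> D" "a \<noteq> b" "a \<otimes> b = p \<otimes> inv g"
      using ex_distinct_mult_eq[OF fin Dc, of "p \<otimes> inv g"] p g nl D(2) by auto
    define E where "E = D - {a} - {b}"
    have E: "E \<subseteq> carrier G" "finite E" "E \<subseteq> A" using Dc D by (auto simp: E_def)
    have abc: "a \<in> carrier G" "b \<in> carrier G" using ab Dc by auto
    define r where "r = (\<Otimes>x\<in>E. x)"
    have r: "r \<in> carrier G" using E by (simp add: r_def finprod_id_closed)
    have "b \<in> D - {a}" "D - {a} \<subseteq> carrier G" using ab Dc by auto
    then have "(\<Otimes>x\<in>D - {a}. x) = b \<otimes> r"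
      unfolding r_def E_def using D(3) by (intro finprod_id_remove) auto
    then have "p = a \<otimes> (b \<otimes> r)"
      using finprod_id_remove[OF D(3) Dc ab(1)] by (simp add: p_def)
    then have "p = (p \<otimes> inv g) \<otimes> r" using abc r ab(4) by (simp add: m_assoc[symmetric])
    then have "p \<otimes> \<one> = p \<otimes> (inv g \<otimes> r)" using p g r by (simp add: m_assoc)
    then have "inv g \<otimes> r = \<one>" using p g r by (metis inv_closed l_cancel m_closed one_closed)
    then have "r = g" using g r by (metis inv_closed inv_equality inv_inv m_comm)
    moreover have "card E = h" using D ab by (simp add: E_def card_Diff_singleton)
    ultimately show "g \<in> restricted_sumset G h A"
      using E by (auto simp: restricted_sumset_def r_def)
  qed
qed

text \<open>A subset of size \<open>h\<close> is determined by the one element of \<open>A\<close>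
  that it omits.\<close>

lemma card_restricted_sumset_le:
  assumes "finite A" "A \<subseteq> carrier G" "card A = h + 1"
  shows "card (restricted_sumset G h A) \<le> h + 1"
proof -
  have "restricted_sumset G h A \<subseteq> (\<lambda>a. \<Otimes>x\<in>A - {a}. x) ` A"
  proof
    fix g assume "g \<in> restricted_sumset G h A"
    then obtain B where B: "B \<subseteq> A" "card B = h" "g = (\<Otimes>x\<in>B. x)"
      by (auto simp: restricted_sumset_def)
    have "card (A - B) = 1" using B assms by (simp add: card_Diff_subset finite_subset)
    then obtain a where "A - B = {a}" by (auto simp: card_1_singleton_iff)
    then have "a \<in> A" "B = A - {a}" using B by auto
    then show "g \<in> (\<lambda>a. \<Otimes>x\<in>A - {a}. x) ` A" using B by auto
  qed
  then show ?thesis using assms surj_card_le by metis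
qed

section \<open>Reduction to the complement\<close>

text \<open>Let \<open>p\<close> be the product over the complement \<open>A\<close> of
  \<open>B\<close>. Omitting \<open>a\<close> from \<open>A\<close> leaves product one exactly if
  \<open>a = p\<close>, so the left side says that \<open>p\<close> is not in \<open>A\<close>,
  hence lies in \<open>B\<close>. As \<open>p\<close> times the product over \<open>B\<close> is the
  product over the group, \<open>p\<close> is the only possible \<open>b\<close>.\<close>

lemma one_notin_restricted_sumset_iff:
  assumes fin: "finite (carrier G)" and B: "B \<subseteq> carrier G" and h: "h + 1 + card B = order G"
  shows "\<one> \<notin> restricted_sumset G h (carrier G - B)
    \<longleftrightarrow> (\<exists>b\<in>B. (\<Otimes>x\<in>B. x) \<otimes> b = (\<Otimes>x\<in>carrier G. x))"
proof -
  define A where "A = carrier G - B"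
  define p where "p = (\<Otimes>x\<in>A. x)"
  have A: "A \<subseteq> carrier G" "finite A" using fin by (auto simp: A_def)
  have finB: "finite B" using B fin by (rule finite_subset)
  have cA: "card A = h + 1" using h B finB by (simp add: A_def card_Diff_subset order_def)
  have p: "p \<in> carrier G" using A by (simp add: p_def finprod_id_closed)
  have *: "\<one> \<in> restricted_sumset G h A \<longleftrightarrow> p \<in> A"
  proof
    assume "\<one> \<in> restricted_sumset G h A"
    then obtain C where C: "C \<subseteq> A" "card C = h" "(\<Otimes>x\<in>C. x) = \<one>"
      by (auto simp: restricted_sumset_def)
    have "card (A - C) = 1" using C A cA by (simp add: card_Diff_subset finite_subset)
    then obtain a where "A - C = {a}" by (auto simp: card_1_singleton_iff)
    then have a: "a \<in> A" "C = A - {a}" using C by auto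
    have "p = a \<otimes> \<one>" unfolding p_def using finprod_id_remove[of A a] A a C by simp
    moreover have "a \<in> carrier G" using a(1) A(1) by blast
    ultimately show "p \<in> A" using a(1) by simp
  next
    assume pA: "p \<in> A"
    define r where "r = (\<Otimes>x\<in>A - {p}. x)"
    have r: "r \<in> carrier G" using A by (auto simp: r_def intro!: finprod_id_closed)
    have "p = p \<otimes> r" using finprod_id_remove[of A p] A pA by (simp add: p_def r_def)
    then have "r = \<one>" using p r by (metis l_cancel_one)
    moreover have "card (A - {p}) = h" using pA A cA by simp
    ultimately show "\<one> \<in> restricted_sumset G h A"
      unfolding restricted_sumset_def using A r_def by (auto intro!: exI[of _ "A - {p}"])
  qed
  have "A \<union> B = carrier G" using B by (auto simp: A_def)
  then have s: "(\<Otimes>x\<in>carrier G. x) = p \<otimes> (\<Otimes>x\<in>B. x)"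
    using finprod_id_Un_disjoint[of A B] A B finB by (auto simp: A_def p_def)
  have "(\<Otimes>x\<in>B. x) \<otimes> b = (\<Otimes>x\<in>carrier G. x) \<longleftrightarrow> b = p" if "b \<in> B" for b
  proof -
    have "b \<in> carrier G" using that B by auto
    then show ?thesis
      using p finprod_id_closed[OF B] m_comm[OF p finprod_id_closed[OF B]] by (simp add: s)
  qed
  moreover have "p \<notin> A \<longleftrightarrow> p \<in> B" using p by (auto simp: A_def)
  ultimately show ?thesis using * by (auto simp: A_def)
qed

text \<open>Adding pairs of mutually inverse elements changes neither the product nor the role of
  \<open>b\<close>.\<close>

lemma extend_by_inverse_pairs:
  assumes fin: "finite (carrier G)" and T: "T \<subseteq> carrier G" and b: "b \<in> T"
    and s: "(\<Otimes>x\<in>T. x) \<otimes> b = s"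
    and k: "card T \<le> k" "even (k - card T)" "2 * k + card (involution_subgroup G) \<le> order G"
  shows "\<exists>B\<subseteq>carrier G. card B = k \<and> (\<exists>b\<in>B. (\<Otimes>x\<in>B. x) \<otimes> b = s)"
proof -
  let ?L = "involution_subgroup G" and ?i = "\<lambda>x. inv x"
  \<comment> \<open>The inverses of \<open>T\<close> are excluded too, so that \<open>S\<close> is
    closed under inversion. At most \<open>l + 2 * card T\<close> elements are lost, so at least
    \<open>2 * (k - card T)\<close> remain by the bound on \<open>k\<close>, enough for the
    \<open>k - card T\<close> elements to be added.\<close>
  define S where "S = carrier G - (?L \<union> T \<union> ?i ` T)"
  have finT: "finite T" using T fin by (rule finite_subset)
  have L: "?L \<subseteq> carrier G" by (auto simp: involution_subgroup_def)
  have finL: "finite ?L" using L fin by (rule finite_subset)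
  have "card (?L \<union> T \<union> ?i ` T) \<le> card ?L + card T + card T"
    using card_Un_le[of "?L \<union> T" "?i ` T"] card_Un_le[of ?L T] card_image_le[OF finT, of ?i]
    by linarith
  moreover have "card S = order G - card (?L \<union> T \<union> ?i ` T)"
    unfolding S_def order_def using L T finL finT by (intro card_Diff_subset) auto
  moreover obtain j where j: "k - card T = 2 * j" using k(2) evenE by blast
  ultimately have jS: "2 * j \<le> card S" using k by linarith
  have S: "inv x \<in> S" "inv x \<noteq> x" "inv (inv x) = x" "x \<otimes> inv x = \<one>" if x: "x \<in> S" for x
  proof -
    have xc: "x \<in> carrier G" "x \<notin> ?L" "x \<notin> T" "x \<notin> ?i ` T" using x by (auto simp: S_def)
    show "inv x \<noteq> x" "inv (inv x) = x" "x \<otimes> inv x = \<one>" using xc inv_eq_self_iff by auto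
    have "inv x \<notin> ?L" using xc by (metis inv_closed inv_eq_self_iff inv_inv)
    moreover have "inv x \<notin> T" using xc by (metis image_eqI inv_inv)
    moreover have "inv x \<notin> ?i ` T" using xc T by (metis imageE inv_inv subsetD)
    ultimately show "inv x \<in> S" using xc by (auto simp: S_def)
  qed
  have finS: "finite S" using fin by (simp add: S_def)
  obtain U where U: "U \<subseteq> S" "card U = 2 * j" "?i ` U \<subseteq> U"
    using ex_involution_closed_subset[OF finS, of ?i, OF S(1-3) jS] by auto
  have UG: "U \<subseteq> carrier G" "finite U" "T \<inter> U = {}"
    using U(1) finS by (auto simp: S_def intro: finite_subset)
  have "(\<Otimes>x\<in>U. x) = \<one> [^] (card U div 2)"
    using UG U S by (intro finprod_id_involution[where f = ?i]) auto
  then have "(\<Otimes>x\<in>T \<union> U. x) = (\<Otimes>x\<in>T. x)"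
    using finprod_id_Un_disjoint[of T U] finT UG T finprod_id_closed[OF T] by simp
  moreover have "card (T \<union> U) = k" using card_Un_disjoint[OF finT UG(2,3)] U(2) j k(1) by simp
  ultimately show ?thesis using T UG b s by (intro exI[of _ "T \<union> U"]) auto
qed

section \<open>The exponent and the two exceptional conditions\<close>

lemma group_exponent_props:
  assumes "finite (carrier G)"
  shows "group_exponent G > 0" "\<And>g. g \<in> carrier G \<Longrightarrow> g [^] group_exponent G = \<one>"
proof -
  have "order G > 0 \<and> (\<forall>g\<in>carrier G. g [^] order G = \<one>)"
    using assms pow_order_eq_1 by (simp add: order_gt_0_iff_finite)
  then have "group_exponent G > 0 \<and> (\<forall>g\<in>carrier G. g [^] group_exponent G = \<one>)"
    unfolding group_exponent_def by (rule LeastI)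
  then show "group_exponent G > 0" "\<And>g. g \<in> carrier G \<Longrightarrow> g [^] group_exponent G = \<one>" by auto
qed

lemma group_exponent_le:
  assumes "m > 0" "\<And>g. g \<in> carrier G \<Longrightarrow> g [^] m = \<one>"
  shows "group_exponent G \<le> m"
  unfolding group_exponent_def using assms by (intro Least_le) auto

text \<open>For \<open>l = 2\<close> the product is the unique involution \<open>e\<close>. It is a
  square exactly if some element has order 4, that is, if 4 divides the exponent, which is even
  because of \<open>e\<close>. For other \<open>l\<close> the product is one.\<close>

lemma finprod_carrier_square_iff:
  assumes fin: "finite (carrier G)"
  shows "(\<exists>b\<in>carrier G. b \<otimes> b = (\<Otimes>x\<in>carrier G. x))
    \<longleftrightarrow> \<not> (card (involution_subgroup G) = 2 \<and> group_exponent G mod 4 = 2)"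
proof (cases "card (involution_subgroup G) = 2")
  case False
  then show ?thesis using finprod_carrier_eq_one[OF fin] by (auto intro!: bexI[of _ \<one>])
next
  case True
  let ?L = "involution_subgroup G" and ?q = "group_exponent G"
  obtain x y where xy: "?L = {x, y}" "x \<noteq> y" using True by (auto simp: card_2_iff)
  then have "\<one> = x \<or> \<one> = y" using one_in_involution_subgroup by auto
  then obtain e where e: "?L = {\<one>, e}" "e \<noteq> \<one>" using xy by (auto simp: insert_commute)
  have s: "(\<Otimes>x\<in>carrier G. x) = e"
    using finprod_carrier_eq_involution[OF fin True] e by auto
  have "e \<in> ?L" using e by simp
  then have ec: "e \<in> carrier G" "e \<otimes> e = \<one>" by (simp_all add: involution_subgroup_iff)
  have ev: "e [^] (2 * i) = \<one>" for i :: nat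
    using ec nat_pow_pow[of e 2 i] by (simp add: numeral_2_eq_2)
  have "even ?q"
  proof (rule ccontr)
    assume "odd ?q"
    then obtain i where "?q = Suc (2 * i)" by (metis oddE Suc_eq_plus1)
    then show False using group_exponent_props(2)[OF fin ec(1)] ev ec e(2) by simp
  qed
  have "(\<exists>b\<in>carrier G. b \<otimes> b = e) \<longleftrightarrow> ?q mod 4 \<noteq> 2"
  proof
    assume "\<exists>b\<in>carrier G. b \<otimes> b = e"
    then obtain b where b: "b \<in> carrier G" "b [^] (2::nat) = e" by (auto simp: numeral_2_eq_2)
    show "?q mod 4 \<noteq> 2"
    proof
      assume "?q mod 4 = 2"
      then have "?q = 2 * Suc (2 * (?q div 4))" by presburger
      then obtain i where i: "?q = 2 * Suc (2 * i)" by blast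
      \<comment> \<open>Half the exponent is odd here, so the power of \<open>e\<close> is
        \<open>e\<close> itself.\<close>
      have "b [^] ?q = e [^] Suc (2 * i)" unfolding i using b by (metis nat_pow_pow)
      then show False using group_exponent_props(2)[OF fin b(1)] ev ec e(2) by simp
    qed
  next
    assume "?q mod 4 \<noteq> 2"
    then have "?q = 2 * (2 * (?q div 4))" using \<open>even ?q\<close> by presburger
    then obtain i where i: "?q = 2 * (2 * i)" by blast
    have "i > 0" using i group_exponent_props(1)[OF fin] by simp
    \<comment> \<open>By minimality of the exponent some \<open>g\<close> has a nontrivial power
      with exponent \<open>?q / 2\<close>. That power lies in \<open>L\<close>, so it is
      \<open>e\<close>, and the power of \<open>g\<close> with exponent \<open>?q / 4\<close> is a
      square root of it.\<close>
    then have "\<not> ?q \<le> 2 * i" using i by simp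
    then obtain g where g: "g \<in> carrier G" "g [^] (2 * i) \<noteq> \<one>"
      using group_exponent_le[of "2 * i"] \<open>i > 0\<close> by auto
    have "(g [^] (2 * i)) [^] (2::nat) = g [^] ?q"
      unfolding i using g by (simp add: nat_pow_pow mult_ac)
    then have "g [^] (2 * i) \<in> ?L"
      using group_exponent_props(2)[OF fin g(1)] g(1) by (simp add: involution_subgroup_def)
    then have "g [^] (2 * i) = e" using e g by auto
    then have "g [^] i \<otimes> g [^] i = e" using g by (simp add: nat_pow_mult mult_2)
    then show "\<exists>b\<in>carrier G. b \<otimes> b = e" using g by blast
  qed
  then show ?thesis using True s by simp
qed

text \<open>Decides whether some \<open>b\<close> differs from its partner \<open>c\<close> in a
  two-element set \<open>{b, c}\<close> with \<open>c\<close> times the square of \<open>b\<close>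
  equal to the product over the group. Taking \<open>b\<close> to be one shows that a constant cube
  is one; conversely, exponent 3 excludes involutions, so the product over the group is one.\<close>

lemma cube_eq_const_iff:
  assumes fin: "finite (carrier G)" and n: "order G \<ge> 2"
  shows "(\<forall>b\<in>carrier G. b \<otimes> b \<otimes> b = (\<Otimes>x\<in>carrier G. x)) \<longleftrightarrow> group_exponent G = 3"
    (is "(\<forall>b\<in>_. _ = ?s) \<longleftrightarrow> ?q = 3")
proof
  have pow3: "b [^] (3::nat) = b \<otimes> b \<otimes> b" if "b \<in> carrier G" for b
    using that by (simp add: numeral_3_eq_3)
  {
    assume all: "\<forall>b\<in>carrier G. b \<otimes> b \<otimes> b = ?s"
    then have "?s = \<one>" using one_closed by force
    then have "?q \<le> 3" using all pow3 by (intro group_exponent_le) auto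
    moreover obtain g where g: "g \<in> carrier G" "g \<noteq> \<one>"
      using ex_notin_card_less[of "{\<one>}" "carrier G"] n by (auto simp: order_def)
    moreover have "?q \<noteq> 1" using group_exponent_props(2)[OF fin g(1)] g by auto
    moreover have "?q \<noteq> 2"
    proof
      assume "?q = 2"
      then have "g \<otimes> g = \<one>" using group_exponent_props(2)[OF fin g(1)] g by (simp add: numeral_2_eq_2)
      then show False using all \<open>?s = \<one>\<close> g by auto
    qed
    ultimately show "?q = 3" using group_exponent_props(1)[OF fin] by linarith
  }
  assume q: "?q = 3"
  have cube: "b \<otimes> b \<otimes> b = \<one>" if "b \<in> carrier G" for b
    using group_exponent_props(2)[OF fin that] q pow3[OF that] by simp
  then have "involution_subgroup G = {\<one>}"
    using one_in_involution_subgroup by (force simp: involution_subgroup_iff)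
  then show "\<forall>b\<in>carrier G. b \<otimes> b \<otimes> b = ?s" using cube finprod_carrier_eq_one[OF fin] by simp
qed

section \<open>Existence and non-existence of a suitable complement\<close>

lemma ex_finprod_mult_eq_finprod_carrier:
  assumes fin: "finite (carrier G)"
    and k: "1 \<le> k" "2 * k + card (involution_subgroup G) \<le> order G"
    and not2: "\<not> (k = 2 \<and> group_exponent G = 3)"
    and not1: "\<not> (k = 1 \<and> card (involution_subgroup G) = 2 \<and> group_exponent G mod 4 = 2)"
  shows "\<exists>B\<subseteq>carrier G. card B = k \<and> (\<exists>b\<in>B. (\<Otimes>x\<in>B. x) \<otimes> b = (\<Otimes>x\<in>carrier G. x))"
proof -
  let ?L = "involution_subgroup G" and ?q = "group_exponent G"
  define s where "s = (\<Otimes>x\<in>carrier G. x)"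
  have s: "s \<in> carrier G" by (simp add: s_def finprod_id_closed)
  have n: "card (carrier G) \<ge> 2 * k" "order G \<ge> 2" using k by (simp_all add: order_def)
  have "\<exists>T\<subseteq>carrier G. card T \<le> k \<and> even (k - card T) \<and> (\<exists>b\<in>T. (\<Otimes>x\<in>T. x) \<otimes> b = s)"
  proof (cases "even k")
    case ev: True
    show ?thesis
    proof (cases "?q = 3")
      case False
      then obtain b where b: "b \<in> carrier G" "b \<otimes> b \<otimes> b \<noteq> s"
        using cube_eq_const_iff[OF fin n(2)] by (auto simp: s_def)
      define c where "c = s \<otimes> inv (b \<otimes> b)"
      have c: "c \<in> carrier G" using s b by (simp add: c_def)
      have cs: "c \<otimes> (b \<otimes> b) = s" using s b by (simp add: c_def m_assoc)
      \<comment> \<open>Equality would make the cube of \<open>b\<close> equal to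
        \<open>s\<close>.\<close>
      then have "c \<noteq> b" using b by (auto simp: m_assoc)
      moreover have "(\<Otimes>x\<in>{b, c}. x) \<otimes> b = s"
        using \<open>c \<noteq> b\<close> b c cs by (simp add: finprod_id_insert m_ac)
      moreover have "2 \<le> k" using ev k(1) by presburger
      ultimately show ?thesis using b c ev by (intro exI[of _ "{b, c}"]) auto
    next
      case True
      \<comment> \<open>Size 2 is the excluded case, so the group has at least 8 elements and there
        is room to choose \<open>x\<close> and \<open>y\<close>.\<close>
      have k4: "4 \<le> k" using ev k(1) not2 True by presburger
      have cube: "b \<otimes> b \<otimes> b = s" if "b \<in> carrier G" for b
        using cube_eq_const_iff[OF fin n(2)] True that by (auto simp: s_def)
      have s1: "s = \<one>" using cube[OF one_closed] by simp
      obtain x where x: "x \<in> carrier G" "x \<notin> {\<one>}"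
        using ex_notin_card_less[of "{\<one>}" "carrier G"] n k4 by auto
      have "card {\<one>, x, inv x} \<le> 3" by (simp add: card_insert_if)
      then obtain y where y: "y \<in> carrier G" "y \<notin> {\<one>, x, inv x}"
        using ex_notin_card_less[of "{\<one>, x, inv x}" "carrier G"] n k4 by auto
      define z where "z = inv (x \<otimes> y)"
      have z: "z \<in> carrier G" using x y by (simp add: z_def)
      \<comment> \<open>Thus \<open>z = x\<close> would mean that \<open>x\<close> times
        \<open>y\<close> is the square of \<open>x\<close>, forcing \<open>y = x\<close>; likewise
        for \<open>z = y\<close>.\<close>
      have sq: "inv (a \<otimes> a) = a" if "a \<in> carrier G" for a
        using cube[OF that] s1 that by (metis inv_equality m_assoc m_closed m_comm)
      have "x \<otimes> y \<noteq> \<one>" using x y by (metis inv_equality inv_inv m_comm insertCI)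
      then have z1: "z \<noteq> \<one>" using x y by (metis inv_inv inv_one m_closed z_def)
      have zx: "z \<noteq> x"
      proof
        assume "z = x"
        then have "x \<otimes> y = x \<otimes> x" using sq[of x] x y by (metis inv_inv m_closed z_def)
        then show False using x y by auto
      qed
      have zy: "z \<noteq> y"
      proof
        assume "z = y"
        then have "x \<otimes> y = y \<otimes> y" using sq[of y] x y by (metis inv_inv m_closed z_def)
        then show False using x y by auto
      qed
      have dist: "\<one> \<noteq> x" "\<one> \<noteq> y" "\<one> \<noteq> z" "x \<noteq> y" "x \<noteq> z" "y \<noteq> z"
        using x y z1 zx zy by auto
      have "x \<otimes> (y \<otimes> z) = \<one>" using x y z by (simp add: z_def m_assoc[symmetric])
      then have "(\<Otimes>x\<in>{\<one>, x, y, z}. x) \<otimes> \<one> = s"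
        using dist x y z s1 by (simp add: finprod_id_insert)
      moreover have "card {\<one>, x, y, z} = 4" using dist by simp
      ultimately show ?thesis using x y z k4 ev
        by (intro exI[of _ "{\<one>, x, y, z}"]) (auto simp del: card_insert_disjoint)
    qed
  next
    case odd: False
    show ?thesis
    proof (cases "\<exists>b\<in>carrier G. b \<otimes> b = s")
      case True
      then obtain b where b: "b \<in> carrier G" "b \<otimes> b = s" by auto
      have "(\<Otimes>x\<in>{b}. x) \<otimes> b = s" using b by (simp add: finprod_id_insert)
      then show ?thesis using b odd k(1) by (intro exI[of _ "{b}"]) auto
    next
      case False
      then have "k \<noteq> 1" using not1 finprod_carrier_square_iff[OF fin] by (auto simp: s_def)
      then have k3: "3 \<le> k" using odd k(1) by presburger
      have "card {\<one>, s} \<le> 2" by (simp add: card_insert_if)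
      then obtain x where x: "x \<in> carrier G" "x \<notin> {\<one>, s}"
        using ex_notin_card_less[of "{\<one>, s}" "carrier G"] n k3 by auto
      define y where "y = s \<otimes> inv x"
      have y: "y \<in> carrier G" using s x by (simp add: y_def)
      have yx: "x \<otimes> y = s" using s x by (simp add: y_def m_lcomm)
      \<comment> \<open>\<open>y\<close> is not one because \<open>x\<close> differs from
        \<open>s\<close>, and \<open>y\<close> is not \<open>x\<close> because \<open>s\<close> has
        no square root.\<close>
      then have dist: "\<one> \<noteq> x" "\<one> \<noteq> y" "x \<noteq> y" using x False by auto
      then have "(\<Otimes>x\<in>{\<one>, x, y}. x) \<otimes> \<one> = s"
        using x y yx s by (simp add: finprod_id_insert)
      moreover have "card {\<one>, x, y} = 3" using dist by simp
      ultimately show ?thesis using x y k3 odd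
        by (intro exI[of _ "{\<one>, x, y}"]) (auto simp del: card_insert_disjoint)
    qed
  qed
  then show ?thesis
    using extend_by_inverse_pairs[OF fin] k(2) by (metis s_def)
qed

text \<open>For \<open>B = {b, c}\<close> the equation says that \<open>c\<close> times the square
  of \<open>b\<close> is the constant cube, whence \<open>c = b\<close>. For \<open>B = {b}\<close>
  it asks for a square root that does not exist.\<close>

lemma not_ex_finprod_mult_eq_finprod_carrier:
  assumes fin: "finite (carrier G)" and n: "order G \<ge> 2" and B: "B \<subseteq> carrier G" "b \<in> B"
    and k: "card B = 2 \<and> group_exponent G = 3
      \<or> card B = 1 \<and> card (involution_subgroup G) = 2 \<and> group_exponent G mod 4 = 2"
  shows "(\<Otimes>x\<in>B. x) \<otimes> b \<noteq> (\<Otimes>x\<in>carrier G. x)"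
proof
  assume eq: "(\<Otimes>x\<in>B. x) \<otimes> b = (\<Otimes>x\<in>carrier G. x)" (is "_ = ?s")
  have b: "b \<in> carrier G" using B by auto
  show False using k
  proof
    assume *: "card B = 2 \<and> group_exponent G = 3"
    then obtain c where c: "B = {b, c}" "c \<noteq> b" using B(2) by (auto simp: card_2_iff)
    have cc: "c \<in> carrier G" using c B by auto
    have "c \<otimes> (b \<otimes> b) = ?s" using eq c cc b by (simp add: finprod_id_insert m_ac)
    moreover have "b \<otimes> (b \<otimes> b) = ?s" using cube_eq_const_iff[OF fin n] * b by (simp add: m_assoc)
    ultimately show False using c cc b by (metis m_closed right_cancel)
  next
    assume *: "card B = 1 \<and> card (involution_subgroup G) = 2 \<and> group_exponent G mod 4 = 2"
    then have "B = {b}" using B(2) by (auto simp: card_1_singleton_iff)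
    then have "b \<otimes> b = ?s" using eq b by (simp add: finprod_id_insert)
    then show False using finprod_carrier_square_iff[OF fin] b * by blast
  qed
qed

section \<open>The values of \<open>C_num\<close> and \<open>Z_num\<close>\<close>

lemma C_num_eq:
  assumes fin: "finite (carrier G)"
    and nl: "order G + card (involution_subgroup G) \<le> 2 * h + 2" and h: "h + 2 \<le> order G"
  shows "C_num G h = h + 1"
  unfolding C_num_def
proof (rule Max_eqI)
  show "finite {card A |A. A \<subseteq> carrier G \<and> restricted_sumset G h A \<noteq> carrier G}"
    using fin by simp
  show "m \<le> h + 1"
    if mem: "m \<in> {card A |A. A \<subseteq> carrier G \<and> restricted_sumset G h A \<noteq> carrier G}" for m
  proof (rule ccontr)
    assume m: "\<not> m \<le> h + 1"
    obtain A where A: "A \<subseteq> carrier G" "card A = m" "restricted_sumset G h A \<noteq> carrier G" using mem by auto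
    then have "restricted_sumset G h A = carrier G"
      using m nl by (intro restricted_sumset_eq_carrier fin) auto
    then show False using A by simp
  qed
  obtain A where A: "A \<subseteq> carrier G" "card A = h + 1" "finite A"
    using h obtain_subset_with_card_n[of "h + 1" "carrier G"] by (auto simp: order_def)
  then have "restricted_sumset G h A \<noteq> carrier G"
    using card_restricted_sumset_le[of A h] h by (auto simp: order_def)
  then show "h + 1 \<in> {card A |A. A \<subseteq> carrier G \<and> restricted_sumset G h A \<noteq> carrier G}"
    using A by (auto intro!: exI[of _ A])
qed

lemma Z_num_eq:
  assumes fin: "finite (carrier G)" and n: "order G \<ge> 2"
    and nl: "order G + card (involution_subgroup G) \<le> 2 * h + 2" and h: "h + 2 \<le> order G"
  shows "Z_num G h = (if h + 3 = order G \<and> group_exponent G = 3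
    \<or> h + 2 = order G \<and> card (involution_subgroup G) = 2 \<and> group_exponent G mod 4 = 2
    then h else h + 1)"
proof -
  let ?L = "involution_subgroup G" and ?q = "group_exponent G"
  let ?M = "{card A |A. A \<subseteq> carrier G \<and> \<one> \<notin> restricted_sumset G h A}"
  \<comment> \<open>The size of the complement of a set with \<open>h + 1\<close> elements; the two
    exceptions are \<open>k = 2\<close> and \<open>k = 1\<close>.\<close>
  define k where "k = order G - (h + 1)"
  have finM: "finite ?M" using fin by simp
  have le: "m \<le> h + 1" if mem: "m \<in> ?M" for m
  proof (rule ccontr)
    assume m: "\<not> m \<le> h + 1"
    obtain A where A: "A \<subseteq> carrier G" "card A = m" "\<one> \<notin> restricted_sumset G h A" using mem by auto
    then have "restricted_sumset G h A = carrier G"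
      using m nl by (intro restricted_sumset_eq_carrier fin) auto
    then show False using A by simp
  qed
  show ?thesis
  proof (cases "h + 3 = order G \<and> ?q = 3 \<or> h + 2 = order G \<and> card ?L = 2 \<and> ?q mod 4 = 2")
    case exc: True
    have "h + 1 \<notin> ?M"
    proof
      assume "h + 1 \<in> ?M"
      then obtain A where A: "A \<subseteq> carrier G" "card A = h + 1" "\<one> \<notin> restricted_sumset G h A" by auto
      define B where "B = carrier G - A"
      have B: "B \<subseteq> carrier G" "carrier G - B = A" using A by (auto simp: B_def)
      have cB: "h + 1 + card B = order G"
        using A fin h by (simp add: B_def card_Diff_subset finite_subset order_def)
      then have "\<exists>b\<in>B. (\<Otimes>x\<in>B. x) \<otimes> b = (\<Otimes>x\<in>carrier G. x)"
        using one_notin_restricted_sumset_iff[OF fin B(1) cB] A B by simp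
      moreover have "card B = 2 \<and> ?q = 3 \<or> card B = 1 \<and> card ?L = 2 \<and> ?q mod 4 = 2"
        using exc cB by auto
      ultimately show False using not_ex_finprod_mult_eq_finprod_carrier[OF fin n B(1)] by blast
    qed
    moreover have "h \<in> ?M"
    proof -
      have "finite ?L" using fin by (simp add: involution_subgroup_def)
      then have "card ?L > 0" using one_in_involution_subgroup by (auto simp: card_gt_0_iff)
      \<comment> \<open>This makes \<open>h - 1\<close> a genuine subtraction. A set of size
        \<open>h\<close> is then built from \<open>h - 1\<close> arbitrary elements and a last one
        that avoids both them and the inverse of their product.\<close>
      then have "h \<ge> 1" using nl n by linarith
      have "h - 1 \<le> card (carrier G)" using h by (simp add: order_def)
      then obtain D where D: "D \<subseteq> carrier G" "card D = h - 1" "finite D"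
        by (rule obtain_subset_with_card_n)
      let ?d = "\<Otimes>x\<in>D. x"
      have d: "?d \<in> carrier G" using D by (simp add: finprod_id_closed)
      have "card (insert (inv ?d) D) < card (carrier G)"
        using card_insert_le_m1[of h D "inv ?d"] D h \<open>h \<ge> 1\<close> by (simp add: order_def)
      then obtain x where x: "x \<in> carrier G" "x \<notin> insert (inv ?d) D"
        using ex_notin_card_less[of "insert (inv ?d) D" "carrier G"] D by auto
      let ?A = "insert x D"
      have cA: "card ?A = h" "?A \<subseteq> carrier G" "finite ?A" using x D \<open>h \<ge> 1\<close> by auto
      have "(\<Otimes>x\<in>?A. x) \<noteq> \<one>"
        using x D d inv_equality[of x ?d] by (auto simp: finprod_id_insert)
      \<comment> \<open>The restricted sumset of a set of size \<open>h\<close> consists of its full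
        product alone.\<close>
      moreover have "B = ?A" if "B \<subseteq> ?A" "card B = h" for B
        using that cA by (metis card_subset_eq)
      ultimately have "\<one> \<notin> restricted_sumset G h ?A"
        unfolding restricted_sumset_def by (smt (verit) mem_Collect_eq)
      then show ?thesis using cA by (intro CollectI exI[of _ ?A]) auto
    qed
    moreover have "m \<le> h" if "m \<in> ?M" for m
    proof -
      have "m \<noteq> h + 1" using that \<open>h + 1 \<notin> ?M\<close> by blast
      then show ?thesis using le[OF that] by linarith
    qed
    ultimately have "Max ?M = h" using finM by (intro Max_eqI)
    then show ?thesis using exc by (simp add: Z_num_def)
  next
    case reg: False
    have "1 \<le> k" "2 * k + card ?L \<le> order G" using h nl by (auto simp: k_def)
    moreover have "\<not> (k = 2 \<and> ?q = 3)" "\<not> (k = 1 \<and> card ?L = 2 \<and> ?q mod 4 = 2)"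
      using reg h by (auto simp: k_def)
    ultimately obtain B where B: "B \<subseteq> carrier G" "card B = k"
      "\<exists>b\<in>B. (\<Otimes>x\<in>B. x) \<otimes> b = (\<Otimes>x\<in>carrier G. x)"
      using ex_finprod_mult_eq_finprod_carrier[OF fin] by metis
    have cB: "h + 1 + card B = order G" using B h by (simp add: k_def)
    have "\<one> \<notin> restricted_sumset G h (carrier G - B)"
      using one_notin_restricted_sumset_iff[OF fin B(1) cB] B by blast
    moreover have "card (carrier G - B) = h + 1"
      using cB B fin by (simp add: card_Diff_subset finite_subset order_def)
    ultimately have "h + 1 \<in> ?M" by (intro CollectI exI[of _ "carrier G - B"]) auto
    then have "Max ?M = h + 1" using le finM by (intro Max_eqI) auto
    then show ?thesis unfolding Z_num_def using reg by (simp only: if_False)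
  qed
qed

end

theorem theorem1p2:
  fixes G :: "('a, 'b) monoid_scheme" and n q l h :: nat
  assumes "comm_group G"
    and "finite (carrier G)"
    and "n = order G" and "n \<ge> 2"
    and "q = group_exponent G"
    and "l = card (involution_subgroup G)"
    and "(real n + real l) / 2 - 1 \<le> real h" and "real h \<le> real n - 2"
  shows "(h + 3 = n \<and> q = 3 \<longrightarrow> C_num G h = h + 1 \<and> Z_num G h = h)
       \<and> (h + 2 = n \<and> l = 2 \<and> q mod 4 = 2 \<longrightarrow> C_num G h = h + 1 \<and> Z_num G h = h)
       \<and> (\<not> (h + 3 = n \<and> q = 3) \<and> \<not> (h + 2 = n \<and> l = 2 \<and> q mod 4 = 2)
            \<longrightarrow> C_num G h = h + 1 \<and> Z_num G h = h + 1)"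
proof -
  interpret comm_group G by fact
  \<comment> \<open>Clearing the denominator turns the bound into one between naturals, with no
    truncated subtraction.\<close>
  have "real (n + l) \<le> real (2 * h + 2)" using assms(7) by (simp add: field_simps)
  then have "n + l \<le> 2 * h + 2" by (simp only: of_nat_le_iff)
  moreover have "h + 2 \<le> n" using assms(8) by linarith
  ultimately have "C_num G h = h + 1"
    "Z_num G h = (if h + 3 = n \<and> q = 3 \<or> h + 2 = n \<and> l = 2 \<and> q mod 4 = 2 then h else h + 1)"
    using C_num_eq Z_num_eq assms(2-6) by auto
  then show ?thesis by auto
qed

end
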